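(* For any $0<\varepsilon<1$, up to $O(1)$ multiplicative factors (constants that may depend on $\varepsilon$ but not on $f$ or $n$), for any (possibly partial) Boolean function $f:\mathcal{D}\subseteq\{0,1\}^n\to\{0,1\}$, $$\mathrm{deg}^{\mathsf{cert}}(f)=\widetilde{\mathrm{osdeg}}_\varepsilon^{\mathsf{cert}}(f)\le\mathsf{Q}_0^{\mathsf{cert}}(f).$$
   Context: A (possibly partial) Boolean function is a map $f:\mathcal{D}\to\{0,1\}$ with $\mathcal{D}\subseteq\{0,1\}^n$. For $z\in\mathcal{D}$, $f^{\mathsf{cert}}_z$ is the partial function with domain $\{z\}\cup\{y\in\mathcal{D}: f(y)\ne f(z)\}$, with $f^{\mathsf{cert}}_z(z)=1$ and $f^{\mathsf{cert}}_z(y)=0$ whenever $f(y)\neq f(z)$. For a complexity measure $\mathsf{M}$, $\mathsf{M}^{\mathsf{cert}}(f):=\max_{z\in\mathcal{D}}\mathsf{M}(f^{\mathsf{cert}}_z)$. For $\varepsilon_0,\varepsilon_1\ge0$, let $\Delta_{\varepsilon_0,\varepsilon_1,1}(f)$ be the minimum degree of a multilinear real polynomial $P$ such that $|P(x)-f(x)|\le\varepsilon_0$ for all $x\in f^{-1}(0)$, $|P(x)-f(x)|\le\varepsilon_1$ for all $x\in f^{-1}(1)$, and $P(x)\in[0,1]$ for all $x\in\{0,1\}^n$. The (exact) bounded-polynomial degree is $\mathrm{deg}(f)=\Delta_{0,0,1}(f)$. The one-sided-error $\varepsilon$-approximate bounded-polynomial degree is $\widetilde{\mathrm{osdeg}}_\varepsilon(f)=\max\{\Delta_{\varepsilon,0,1}(f),\Delta_{0,\varepsilon,1}(f)\}$.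 $\mathsf{Q}_0(f)$ (zero-error quantum query complexity) is the minimum number of queries, in the standard quantum query model, of a quantum algorithm with outputs in $\{0,1,\bot\}$ that, on every $x\in\mathcal{D}$, outputs $\bot$ with probability at most $1/2$ and never outputs $1-f(x)$. *)

theory Defs
  imports Complex_Main "HOL-Library.Extended_Nat"
begin

text \<open>
  A partial Boolean function on \<open>n\<close> bits is a map \<open>f :: bool list \<rightharpoonup> bool\<close> whose
  domain \<open>dom f\<close> is a set of strings of length \<open>n\<close>.
\<close>

definition cube :: "nat \<Rightarrow> bool list set" where
  "cube n = {x. length x = n}"

definition partial_boolean :: "nat \<Rightarrow> (bool list \<rightharpoonup> bool) \<Rightarrow> bool" where
  "partial_boolean n f \<longleftrightarrow> dom f \<subseteq> cube n"

text \<open>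
  Measures take values in \<^typ>\<open>enat\<close>. As \<^typ>\<open>enat\<close> is well-ordered, the infima below are minima
  whenever they range over a nonempty set.
\<close>

type_synonym complexity_measure = "nat \<Rightarrow> (bool list \<rightharpoonup> bool) \<Rightarrow> enat"

definition fcert :: "(bool list \<rightharpoonup> bool) \<Rightarrow> bool list \<Rightarrow> (bool list \<rightharpoonup> bool)" where
  "fcert f z = (\<lambda>y. if y = z then Some True
                    else if y \<in> dom f \<and> f y \<noteq> f z then Some False
                    else None)"

text \<open>The domain is finite, so the supremum is a maximum; for the empty function it is \<open>0\<close>.\<close>

definition cert_measure :: "complexity_measure \<Rightarrow> complexity_measure" where
  "cert_measure M n f = (SUP z\<in>dom f. M n (fcert f z))"

text \<open>
  A multilinear polynomial in the variables \<open>x\<^sub>0, \<dots>, x\<^sub>n\<^sub>-\<^sub>1\<close> is given by the coefficients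
  \<open>c S\<close> of the monomials \<open>\<Prod>i\<in>S. x\<^sub>i\<close> for \<open>S \<subseteq> {..<n}\<close>; values of \<open>c\<close> on other sets are
  ignored. The zero polynomial has degree \<open>0\<close>.
\<close>

definition poly_eval :: "nat \<Rightarrow> (nat set \<Rightarrow> real) \<Rightarrow> bool list \<Rightarrow> real" where
  "poly_eval n c x = (\<Sum>S\<in>Pow {..<n}. c S * (\<Prod>i\<in>S. of_bool (x ! i)))"

definition poly_degree :: "nat \<Rightarrow> (nat set \<Rightarrow> real) \<Rightarrow> nat" where
  "poly_degree n c = Max (insert 0 (card ` {S. S \<subseteq> {..<n} \<and> c S \<noteq> 0}))"

definition bounded_approx ::
    "real \<Rightarrow> real \<Rightarrow> nat \<Rightarrow> (bool list \<rightharpoonup> bool) \<Rightarrow> (nat set \<Rightarrow> real) \<Rightarrow> bool" where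
  "bounded_approx \<epsilon>0 \<epsilon>1 n f c \<longleftrightarrow>
     (\<forall>x. f x = Some False \<longrightarrow> \<bar>poly_eval n c x - 0\<bar> \<le> \<epsilon>0) \<and>
     (\<forall>x. f x = Some True \<longrightarrow> \<bar>poly_eval n c x - 1\<bar> \<le> \<epsilon>1) \<and>
     (\<forall>x\<in>cube n. poly_eval n c x \<in> {0..1})"

definition Delta :: "real \<Rightarrow> real \<Rightarrow> complexity_measure" where
  "Delta \<epsilon>0 \<epsilon>1 n f = (INF c\<in>{c. bounded_approx \<epsilon>0 \<epsilon>1 n f c}. enat (poly_degree n c))"

definition bdeg :: complexity_measure where
  "bdeg = Delta 0 0"

definition osdeg :: "real \<Rightarrow> complexity_measure" where
  "osdeg \<epsilon> n f = max (Delta \<epsilon> 0 n f) (Delta 0 \<epsilon> n f)"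

text \<open>
  Basis states \<open>|i, b, w\<rangle>\<close> consist of a query index, a target bit and a workspace index.
  The query index ranges over \<open>{..n}\<close>: the positions of the input are \<open>i < n\<close>, while \<open>i = n\<close>
  is the null query, on which the oracle acts as the identity (it also makes the state space
  nontrivial for \<open>n = 0\<close>).
\<close>

type_synonym basis = "nat \<times> bool \<times> nat"
type_synonym amplitudes = "basis \<Rightarrow> complex"

definition basis_states :: "nat \<Rightarrow> nat \<Rightarrow> basis set" where
  "basis_states n W = {..n} \<times> UNIV \<times> {..<W}"

record query_algorithm =
  workdim :: nat
  gate :: "nat \<Rightarrow> basis \<Rightarrow> basis \<Rightarrow> complex"
  outcome :: "basis \<Rightarrow> bool option"

text \<open>\<open>U s t\<close> is the matrix entry \<open>\<langle>s| U |t\<rangle>\<close>.\<close>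

definition unitary_on :: "basis set \<Rightarrow> (basis \<Rightarrow> basis \<Rightarrow> complex) \<Rightarrow> bool" where
  "unitary_on B U \<longleftrightarrow>
     (\<forall>r\<in>B. \<forall>t\<in>B. (\<Sum>s\<in>B. cnj (U s r) * U s t) = (if r = t then 1 else 0))"

definition apply_gate ::
    "basis set \<Rightarrow> (basis \<Rightarrow> basis \<Rightarrow> complex) \<Rightarrow> amplitudes \<Rightarrow> amplitudes" where
  "apply_gate B U \<psi> = (\<lambda>s. \<Sum>t\<in>B. U s t * \<psi> t)"

text \<open>
  The oracle maps \<open>|i, b, w\<rangle>\<close> to \<open>|i, b \<oplus> x\<^sub>i, w\<rangle>\<close>. It is an involution, so the new amplitude at
  \<open>|i, b, w\<rangle>\<close> is the old one at \<open>|i, b \<oplus> x\<^sub>i, w\<rangle>\<close>.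
\<close>

definition apply_oracle :: "nat \<Rightarrow> bool list \<Rightarrow> amplitudes \<Rightarrow> amplitudes" where
  "apply_oracle n x \<psi> = (\<lambda>(i, b, w). \<psi> (i, b \<noteq> (i < n \<and> x ! i), w))"

definition query_alg :: "nat \<Rightarrow> nat \<Rightarrow> query_algorithm \<Rightarrow> bool" where
  "query_alg n T A \<longleftrightarrow>
     0 < workdim A \<and> (\<forall>t\<le>T. unitary_on (basis_states n (workdim A)) (gate A t))"

text \<open>\<open>state n A x T = U\<^sub>T O\<^sub>x U\<^sub>T\<^sub>-\<^sub>1 \<dots> O\<^sub>x U\<^sub>0 |0, 0, 0\<rangle>\<close>\<close>

fun state :: "nat \<Rightarrow> query_algorithm \<Rightarrow> bool list \<Rightarrow> nat \<Rightarrow> amplitudes" where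
  "state n A x 0 =
     apply_gate (basis_states n (workdim A)) (gate A 0)
       (\<lambda>s. if s = (0, False, 0) then 1 else 0)"
| "state n A x (Suc t) =
     apply_gate (basis_states n (workdim A)) (gate A (Suc t))
       (apply_oracle n x (state n A x t))"

text \<open>
  The final state is measured in the computational basis, and \<open>outcome\<close> assigns to each basis state
  a value, where \<^term>\<open>None\<close> plays the role of \<open>\<bottom>\<close>.
\<close>

definition output_prob ::
    "nat \<Rightarrow> nat \<Rightarrow> query_algorithm \<Rightarrow> bool list \<Rightarrow> bool option \<Rightarrow> real" where
  "output_prob n T A x v =
     (\<Sum>s\<in>{s \<in> basis_states n (workdim A). outcome A s = v}. (cmod (state n A x T s))\<^sup>2)"

definition zero_error :: "nat \<Rightarrow> nat \<Rightarrow> query_algorithm \<Rightarrow> (bool list \<rightharpoonup> bool) \<Rightarrow> bool" where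
  "zero_error n T A f \<longleftrightarrow>
     (\<forall>x v. f x = Some v \<longrightarrow>
        output_prob n T A x None \<le> 1 / 2 \<and> output_prob n T A x (Some (\<not> v)) = 0)"

definition Q0 :: complexity_measure where
  "Q0 n f = (INF T\<in>{T. \<exists>A. query_alg n T A \<and> zero_error n T A f}. enat T)"

end

theory Submission
  imports Defs
begin

text \<open>
  Fix \<open>z\<close> and let \<open>P\<close> be a polynomial with values in \<open>[0, 1]\<close> that vanishes on the \<open>0\<close>-inputs of
  \<open>fcert f z\<close> and has \<open>P z \<ge> 1 / (k + 1)\<close>. Since \<open>z\<close> is the only \<open>1\<close>-input, the error at \<open>z\<close> can be
  removed by composing \<open>P\<close> with one univariate polynomial of degree \<open>k + 1\<close>: for \<open>s = P / P z\<close>,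
  which takes values in \<open>[0, k + 1]\<close>, the polynomial \<open>s * (1 + (1 - s) / k) ^ k\<close> has values in
  \<open>[0, 1]\<close>, vanishes at \<open>s = 0\<close> and equals \<open>1\<close> at \<open>s = 1\<close>. This bounds the exact degree by the
  one-sided-error degree. The probability that a zero-error algorithm outputs \<open>1\<close> is a polynomial
  of degree at most \<open>2 T\<close> to which the same construction applies with \<open>k = 1\<close>.
\<close>

section \<open>Functions represented by polynomials of bounded degree\<close>

text \<open>Degree is attached to the function rather than to its coefficients, so that bounds
  compose under sums and products.\<close>

definition deg_le :: "nat \<Rightarrow> nat \<Rightarrow> (bool list \<Rightarrow> real) \<Rightarrow> bool" where
  "deg_le n d g \<longleftrightarrow> (\<exists>c. (\<forall>S. d < card S \<longrightarrow> c S = 0) \<and> g = poly_eval n c)"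

lemma deg_le_monomial:
  assumes "S \<subseteq> {..<n}" "card S \<le> d"
  shows "deg_le n d (\<lambda>x. a * (\<Prod>i\<in>S. of_bool (x ! i)))"
  unfolding deg_le_def
proof (intro exI conjI)
  let ?c = "\<lambda>R. if R = S then a else 0"
  show "\<forall>R. d < card R \<longrightarrow> ?c R = 0" using assms by auto
  show "(\<lambda>x. a * (\<Prod>i\<in>S. of_bool (x ! i))) = poly_eval n ?c"
  proof
    fix x :: "bool list"
    have "poly_eval n ?c x = (\<Sum>R\<in>Pow {..<n}. if R = S then a * (\<Prod>i\<in>S. of_bool (x ! i)) else 0)"
      unfolding poly_eval_def by (intro sum.cong) auto
    also have "\<dots> = a * (\<Prod>i\<in>S. of_bool (x ! i))"
      using assms by (subst sum.delta) auto
    finally show "a * (\<Prod>i\<in>S. of_bool (x ! i)) = poly_eval n ?c x" by simp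
  qed
qed

lemma deg_le_const: "deg_le n d (\<lambda>x. a)"
  using deg_le_monomial[of "{}" n d a] by simp

lemma deg_le_var: "i < n \<Longrightarrow> deg_le n (Suc 0) (\<lambda>x. of_bool (x ! i))"
  using deg_le_monomial[of "{i}" n "Suc 0" 1] by simp

lemma deg_le_mono: "deg_le n d g \<Longrightarrow> d \<le> e \<Longrightarrow> deg_le n e g"
  unfolding deg_le_def using le_less_trans by blast

lemma deg_le_add:
  assumes "deg_le n d g" "deg_le n d h"
  shows "deg_le n d (\<lambda>x. g x + h x)"
proof -
  from assms obtain b c where b: "\<forall>S. d < card S \<longrightarrow> b S = 0" "g = poly_eval n b"
    and c: "\<forall>S. d < card S \<longrightarrow> c S = 0" "h = poly_eval n c"
    unfolding deg_le_def by blast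
  have "(\<lambda>x. g x + h x) = poly_eval n (\<lambda>S. b S + c S)"
    unfolding b(2) c(2) poly_eval_def by (simp add: distrib_right sum.distrib)
  with b(1) c(1) show ?thesis
    unfolding deg_le_def by (intro exI[of _ "\<lambda>S. b S + c S"]) simp
qed

lemma deg_le_sum:
  assumes "finite A" "\<And>a. a \<in> A \<Longrightarrow> deg_le n d (g a)"
  shows "deg_le n d (\<lambda>x. \<Sum>a\<in>A. g a x)"
  using assms by (induction A) (auto intro: deg_le_const deg_le_add)

text \<open>Bits are idempotent, so the monomials of \<open>S\<close> and \<open>R\<close> multiply
  to that of \<open>S \<union> R\<close>, whose size is at most \<open>card S + card R\<close>; the
  product is thus multilinear again.\<close>

lemma deg_le_mult:
  assumes "deg_le n d g" "deg_le n e h"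
  shows "deg_le n (d + e) (\<lambda>x. g x * h x)"
proof -
  from assms obtain b c where b: "\<forall>S. d < card S \<longrightarrow> b S = 0" "g = poly_eval n b"
    and c: "\<forall>S. e < card S \<longrightarrow> c S = 0" "h = poly_eval n c"
    unfolding deg_le_def by blast
  let ?m = "\<lambda>S x. (\<Prod>i\<in>S. of_bool (x ! i)) :: real"
  have m: "?m S x * ?m R x = ?m (S \<union> R) x" if "S \<subseteq> {..<n}" "R \<subseteq> {..<n}" for S R x
  proof -
    have fin: "finite S" "finite R" using that finite_subset by blast+
    have "?m S x = of_bool (\<forall>i\<in>S. x ! i)" if "finite S" for S
      using that by (induction S) auto
    with fin show ?thesis by (auto simp: ball_Un)
  qed
  have eq: "(\<lambda>x. g x * h x)
      = (\<lambda>x. \<Sum>S\<in>Pow {..<n}. \<Sum>R\<in>Pow {..<n}. b S * c R * ?m (S \<union> R) x)"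
    unfolding b(2) c(2) poly_eval_def sum_product
    by (intro ext sum.cong refl) (simp add: m[symmetric] mult_ac)
  have "deg_le n (d + e) (\<lambda>x. b S * c R * ?m (S \<union> R) x)"
    if "S \<subseteq> {..<n}" "R \<subseteq> {..<n}" for S R
  proof (cases "card S \<le> d \<and> card R \<le> e")
    case True
    then have "card (S \<union> R) \<le> d + e"
      using card_Un_le[of S R] by linarith
    with that show ?thesis by (intro deg_le_monomial) auto
  next
    case False
    then have "b S * c R = 0" using b(1) c(1) by auto
    then show ?thesis using deg_le_const[of n "d + e" 0] by (simp only: mult_zero_left)
  qed
  then show ?thesis unfolding eq by (intro deg_le_sum) auto
qed

lemma deg_le_cmult: "deg_le n d g \<Longrightarrow> deg_le n d (\<lambda>x. a * g x)"
  using deg_le_mult[OF deg_le_const[of n 0 a], of d g] by simp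

lemma deg_le_diff: "deg_le n d g \<Longrightarrow> deg_le n d h \<Longrightarrow> deg_le n d (\<lambda>x. g x - h x)"
  using deg_le_add[of n d g "\<lambda>x. - 1 * h x"] deg_le_cmult[of n d h "- 1"] by simp

lemma deg_le_power: "deg_le n d g \<Longrightarrow> deg_le n (k * d) (\<lambda>x. g x ^ k)"
proof (induction k)
  case 0
  show ?case by (simp add: deg_le_const)
next
  case (Suc k)
  show ?case using deg_le_mult[OF Suc.prems Suc.IH[OF Suc.prems]] by simp
qed

lemma deg_le_poly_eval: "deg_le n (poly_degree n c) (poly_eval n c)"
proof -
  \<comment> \<open>\<open>poly_degree\<close> and \<open>poly_eval\<close> ignore \<open>c\<close>
    outside the subsets of \<open>{..<n}\<close>, while \<open>deg_le\<close> constrains every large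
    set; hence the truncation.\<close>
  define b where "b S = (if S \<subseteq> {..<n} then c S else 0)" for S
  have "finite {S. S \<subseteq> {..<n} \<and> c S \<noteq> 0}"
    by (rule finite_subset[of _ "Pow {..<n}"]) auto
  then have "card S \<le> poly_degree n c" if "b S \<noteq> 0" for S
    using that unfolding poly_degree_def b_def by (intro Max_ge) (auto split: if_splits)
  then have "\<forall>S. poly_degree n c < card S \<longrightarrow> b S = 0"
    using not_le by blast
  moreover have "poly_eval n c = poly_eval n b"
    unfolding poly_eval_def b_def by (intro ext sum.cong) auto
  ultimately show ?thesis unfolding deg_le_def by (intro exI[of _ b] conjI)
qed

lemma Delta_le:
  assumes "deg_le n d P"
    and "\<And>x. g x = Some False \<Longrightarrow> \<bar>P x\<bar> \<le> \<epsilon>0"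
    and "\<And>x. g x = Some True \<Longrightarrow> \<bar>P x - 1\<bar> \<le> \<epsilon>1"
    and "\<And>x. x \<in> cube n \<Longrightarrow> 0 \<le> P x \<and> P x \<le> 1"
  shows "Delta \<epsilon>0 \<epsilon>1 n g \<le> enat d"
proof -
  from assms(1) obtain c where c: "\<forall>S. d < card S \<longrightarrow> c S = 0" "P = poly_eval n c"
    unfolding deg_le_def by blast
  have "bounded_approx \<epsilon>0 \<epsilon>1 n g c"
    using assms(2-4) unfolding bounded_approx_def c(2) by auto
  then have "Delta \<epsilon>0 \<epsilon>1 n g \<le> enat (poly_degree n c)"
    unfolding Delta_def by (intro INF_lower) simp
  also have "poly_degree n c \<le> d"
  proof -
    have "finite {S. S \<subseteq> {..<n} \<and> c S \<noteq> 0}"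
      by (rule finite_subset[of _ "Pow {..<n}"]) auto
    then show ?thesis
      unfolding poly_degree_def using c(1) not_le by (intro Max.boundedI) auto
  qed
  finally show ?thesis by simp
qed

section \<open>Removing the error at a single point\<close>

text \<open>With \<open>y = 1 - s \<ge> - k\<close>, the power is at most \<open>exp y\<close>, and
  \<open>s \<le> exp (s - 1) = exp (- y)\<close>; the two bounds multiply to 1. The condition
  \<open>s \<le> k + 1\<close> keeps the base nonnegative.\<close>

lemma bump_bounds:
  fixes s :: real
  assumes "0 < k" "0 \<le> s" "s \<le> real k + 1"
  shows "0 \<le> s * (1 + (1 - s) / real k) ^ k" "s * (1 + (1 - s) / real k) ^ k \<le> 1"
proof -
  have base: "0 \<le> 1 + (1 - s) / real k"
    using assms by (simp add: field_simps)
  then show "0 \<le> s * (1 + (1 - s) / real k) ^ k"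
    using assms by simp
  have "(1 + (1 - s) / real k) ^ k \<le> exp (1 - s)"
    using assms by (intro exp_ge_one_plus_x_over_n_power_n) auto
  moreover have "s \<le> exp (s - 1)"
    using exp_ge_add_one_self[of "s - 1"] by simp
  ultimately have "s * (1 + (1 - s) / real k) ^ k \<le> exp (s - 1) * exp (1 - s)"
    using assms base by (intro mult_mono) auto
  then show "s * (1 + (1 - s) / real k) ^ k \<le> 1"
    by (simp flip: exp_add)
qed

text \<open>Common tool for approximating polynomials and quantum algorithms. The factor
  \<open>Suc k\<close> counts one copy of \<open>s\<close> and \<open>k\<close> copies of the base,
  each of degree at most \<open>d\<close>.\<close>

lemma bdeg_le_one_sided:
  assumes P: "deg_le n d P" "\<And>x. x \<in> cube n \<Longrightarrow> 0 \<le> P x \<and> P x \<le> 1"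
    and zero: "\<And>x. g x = Some False \<Longrightarrow> P x = 0"
    and one: "\<And>x. g x = Some True \<Longrightarrow> x = z"
    and k: "0 < k" "1 \<le> (real k + 1) * P z"
  shows "bdeg n g \<le> enat (Suc k * d)"
proof -
  define s where "s x = (1 / P z) * P x" for x
  have Pz: "0 < P z"
    using k by (smt (verit) mult_nonneg_nonpos of_nat_0_le_iff)
  have s: "deg_le n d s"
    unfolding s_def by (intro deg_le_cmult P)
  have "deg_le n d (\<lambda>x. 1 + (1 / real k) * (1 - s x))"
    by (intro deg_le_add deg_le_const deg_le_cmult deg_le_diff s)
  from deg_le_mult[OF s deg_le_power[OF this, of k]]
  have deg: "deg_le n (Suc k * d) (\<lambda>x. s x * (1 + (1 - s x) / real k) ^ k)"
    by simp
  show ?thesis unfolding bdeg_def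
  proof (rule Delta_le[OF deg])
    fix x
    assume "g x = Some False"
    then show "\<bar>s x * (1 + (1 - s x) / real k) ^ k\<bar> \<le> 0"
      by (simp add: s_def zero)
  next
    fix x
    assume "g x = Some True"
    then have "s x = 1" using one Pz by (simp add: s_def)
    then show "\<bar>s x * (1 + (1 - s x) / real k) ^ k - 1\<bar> \<le> 0" by simp
  next
    fix x
    assume x: "x \<in> cube n"
    \<comment> \<open>Since \<open>P x \<le> 1\<close> on the whole cube, the rescaled
      \<open>s\<close> stays in \<open>[0, k + 1]\<close> outside the domain of \<open>g\<close>
      too.\<close>
    have "P x \<le> (real k + 1) * P z" using P(2)[OF x] k by linarith
    then have "0 \<le> s x" "s x \<le> real k + 1"
      using P(2)[OF x] Pz by (auto simp: s_def field_simps)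
    with k show "0 \<le> s x * (1 + (1 - s x) / real k) ^ k
        \<and> s x * (1 + (1 - s x) / real k) ^ k \<le> 1"
      using bump_bounds by blast
  qed
qed

text \<open>A nonempty infimum in \<open>enat\<close> is attained. An empty one is infinite, and
  \<open>0 < C\<close> keeps the product infinite, as \<open>0 * \<infinity> = 0\<close>.\<close>

lemma le_mult_INF_enat:
  assumes "0 < C" "\<And>a. a \<in> A \<Longrightarrow> X \<le> enat C * h a"
  shows "X \<le> enat C * (INF a\<in>A. h a)"
proof (cases "A = {}")
  case True
  with assms show ?thesis by (simp add: top_enat_def imult_is_infinity zero_enat_def)
next
  case False
  then have "(INF a\<in>A. h a) \<in> h ` A"
    by (auto simp: Inf_enat_def intro: LeastI)
  with assms(2) show ?thesis by auto
qed

lemma fcert_eq_True_iff: "fcert f z x = Some True \<longleftrightarrow> x = z"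
  by (simp add: fcert_def)

text \<open>In \<open>Delta 0 \<epsilon>\<close> the zeros are exact and the only error is at
  \<open>z\<close>, where the value is at least
  \<open>1 - \<epsilon> \<ge> 1 / (k + 1)\<close>.\<close>

lemma bdeg_fcert_le_osdeg:
  assumes "0 < k" "1 \<le> (real k + 1) * (1 - \<epsilon>)"
  shows "bdeg n (fcert f z) \<le> enat (Suc k) * osdeg \<epsilon> n (fcert f z)"
proof -
  have "bdeg n (fcert f z) \<le> enat (Suc k) * Delta 0 \<epsilon> n (fcert f z)"
    unfolding Delta_def
  proof (rule le_mult_INF_enat)
    fix c
    assume "c \<in> {c. bounded_approx 0 \<epsilon> n (fcert f z) c}"
    then have c: "bounded_approx 0 \<epsilon> n (fcert f z) c" by simp
    then have "1 - \<epsilon> \<le> poly_eval n c z"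
      unfolding bounded_approx_def fcert_eq_True_iff by (auto simp: abs_le_iff)
    then have "(real k + 1) * (1 - \<epsilon>) \<le> (real k + 1) * poly_eval n c z"
      by (intro mult_left_mono) auto
    with assms have "1 \<le> (real k + 1) * poly_eval n c z" by linarith
    with assms(1) c have "bdeg n (fcert f z) \<le> enat (Suc k * poly_degree n c)"
      by (intro bdeg_le_one_sided[OF deg_le_poly_eval, where z = z])
        (auto simp: bounded_approx_def fcert_eq_True_iff)
    then show "bdeg n (fcert f z) \<le> enat (Suc k) * enat (poly_degree n c)"
      by simp
  qed simp
  also have "\<dots> \<le> enat (Suc k) * osdeg \<epsilon> n (fcert f z)"
    by (intro mult_left_mono) (auto simp: osdeg_def)
  finally show ?thesis .
qed

text \<open>An exact polynomial is admissible for either one-sided error, so both infima range over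
  larger sets.\<close>

lemma osdeg_le_bdeg:
  assumes "0 \<le> \<epsilon>"
  shows "osdeg \<epsilon> n g \<le> bdeg n g"
  unfolding osdeg_def bdeg_def Delta_def using assms
  by (auto simp: bounded_approx_def intro!: INF_superset_mono)

section \<open>Zero-error quantum algorithms\<close>

text \<open>Real and imaginary parts are kept apart because \<open>poly_eval\<close> has real
  coefficients and output probabilities are sums of their squares.\<close>

definition complex_deg_le :: "nat \<Rightarrow> nat \<Rightarrow> (bool list \<Rightarrow> complex) \<Rightarrow> bool" where
  "complex_deg_le n d g \<longleftrightarrow> deg_le n d (\<lambda>x. Re (g x)) \<and> deg_le n d (\<lambda>x. Im (g x))"

lemma complex_deg_le_cmult: "complex_deg_le n d g \<Longrightarrow> complex_deg_le n d (\<lambda>x. a * g x)"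
  by (auto simp: complex_deg_le_def intro: deg_le_cmult deg_le_add deg_le_diff)

lemma complex_deg_le_apply_gate:
  assumes "finite B" "\<And>t. complex_deg_le n d (\<lambda>x. \<psi> x t)"
  shows "complex_deg_le n d (\<lambda>x. apply_gate B U (\<psi> x) s)"
proof -
  have "complex_deg_le n d (\<lambda>x. U s t * \<psi> x t)" for t
    by (rule complex_deg_le_cmult[OF assms(2)])
  then show ?thesis
    unfolding complex_deg_le_def apply_gate_def Re_sum Im_sum
    by (intro conjI deg_le_sum assms(1)) auto
qed

text \<open>The queried bit selects between two old amplitudes,
  \<open>x_i * u + (1 - x_i) * v\<close>, which costs one degree; the null query leaves amplitudes
  unchanged.\<close>

lemma complex_deg_le_apply_oracle:
  assumes "\<And>s. complex_deg_le n d (\<lambda>x. \<psi> x s)"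
  shows "complex_deg_le n (Suc d) (\<lambda>x. apply_oracle n x (\<psi> x) s)"
proof (cases s)
  case (fields i b w)
  show ?thesis
  proof (cases "i < n")
    case True
    have select: "deg_le n (Suc d) (\<lambda>x. of_bool (x ! i) * u x + (1 - of_bool (x ! i)) * v x)"
      if "deg_le n d u" "deg_le n d v" for u v
    proof -
      have var: "deg_le n (Suc 0) (\<lambda>x. of_bool (x ! i))" by (rule deg_le_var[OF True])
      have "deg_le n (Suc 0 + d) (\<lambda>x. of_bool (x ! i) * u x)"
        by (rule deg_le_mult[OF var that(1)])
      moreover have "deg_le n (Suc 0 + d) (\<lambda>x. (1 - of_bool (x ! i)) * v x)"
        by (rule deg_le_mult[OF deg_le_diff[OF deg_le_const var] that(2)])
      ultimately show ?thesis using deg_le_add by simp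
    qed
    have *: "Re (apply_oracle n x (\<psi> x) s)
        = of_bool (x ! i) * Re (\<psi> x (i, \<not> b, w)) + (1 - of_bool (x ! i)) * Re (\<psi> x (i, b, w))"
      "Im (apply_oracle n x (\<psi> x) s)
        = of_bool (x ! i) * Im (\<psi> x (i, \<not> b, w)) + (1 - of_bool (x ! i)) * Im (\<psi> x (i, b, w))"
      for x
      using True by (simp_all add: apply_oracle_def fields)
    show ?thesis
      using assms unfolding complex_deg_le_def * by (intro conjI select) auto
  next
    case False
    then show ?thesis
      using assms[of s]
      by (auto simp: apply_oracle_def fields complex_deg_le_def intro: deg_le_mono)
  qed
qed

lemma finite_basis_states: "finite (basis_states n W)"
  by (simp add: basis_states_def)

text \<open>Polynomial method: gates are linear with coefficients independent of the input, so only
  oracle calls raise the degree.\<close>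

lemma complex_deg_le_state: "complex_deg_le n t (\<lambda>x. state n A x t s)"
proof (induction t arbitrary: s)
  case 0
  show ?case by (simp add: complex_deg_le_def deg_le_const)
next
  case (Suc t)
  show ?case unfolding state.simps
    by (intro complex_deg_le_apply_gate finite_basis_states complex_deg_le_apply_oracle Suc)
qed

lemma deg_le_output_prob: "deg_le n (2 * T) (\<lambda>x. output_prob n T A x v)"
  unfolding output_prob_def cmod_power2
  using complex_deg_le_state[of n T A] finite_basis_states
  by (intro deg_le_sum deg_le_add deg_le_power) (auto simp: complex_deg_le_def)

section \<open>Conservation of total probability\<close>

lemma sum_cmod_apply_gate:
  assumes "unitary_on B U" "finite B"
  shows "(\<Sum>s\<in>B. (cmod (apply_gate B U \<psi> s))\<^sup>2) = (\<Sum>s\<in>B. (cmod (\<psi> s))\<^sup>2)"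
proof -
  have "complex_of_real (\<Sum>s\<in>B. (cmod (apply_gate B U \<psi> s))\<^sup>2)
      = (\<Sum>s\<in>B. cnj (\<Sum>r\<in>B. U s r * \<psi> r) * (\<Sum>t\<in>B. U s t * \<psi> t))"
    unfolding of_real_sum complex_norm_square apply_gate_def
    by (intro sum.cong refl mult.commute)
  also have "\<dots> = (\<Sum>s\<in>B. \<Sum>r\<in>B. \<Sum>t\<in>B. cnj (\<psi> r) * \<psi> t * (cnj (U s r) * U s t))"
    unfolding cnj_sum sum_product by (intro sum.cong refl) (simp add: mult_ac)
  \<comment> \<open>Moving the sum over \<open>s\<close> innermost exposes the orthonormality of
    columns in \<open>unitary_on\<close>.\<close>
  also have "\<dots> = (\<Sum>r\<in>B. \<Sum>t\<in>B. \<Sum>s\<in>B. cnj (\<psi> r) * \<psi> t * (cnj (U s r) * U s t))"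
    by (subst sum.swap) (intro sum.cong refl sum.swap)
  also have "\<dots> = (\<Sum>r\<in>B. \<Sum>t\<in>B. if r = t then cnj (\<psi> r) * \<psi> t else 0)"
    using assms(1) unfolding unitary_on_def
    by (intro sum.cong refl) (simp flip: sum_distrib_left)
  also have "\<dots> = (\<Sum>r\<in>B. cnj (\<psi> r) * \<psi> r)"
    using assms(2) by simp
  also have "\<dots> = complex_of_real (\<Sum>s\<in>B. (cmod (\<psi> s))\<^sup>2)"
    unfolding of_real_sum complex_norm_square by (intro sum.cong refl mult.commute)
  finally show ?thesis by (simp only: of_real_eq_iff)
qed

lemma sum_cmod_apply_oracle:
  "(\<Sum>s\<in>basis_states n W. (cmod (apply_oracle n x \<psi> s))\<^sup>2)
     = (\<Sum>s\<in>basis_states n W. (cmod (\<psi> s))\<^sup>2)"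
proof -
  \<comment> \<open>The oracle permutes the basis states by an involution, which therefore serves as
    both reindexing witnesses.\<close>
  let ?\<pi> = "\<lambda>(i, b, w). (i, b \<noteq> (i < n \<and> x ! i), w)"
  show ?thesis
    by (rule sum.reindex_bij_witness[where i = ?\<pi> and j = ?\<pi>])
      (auto simp: basis_states_def apply_oracle_def)
qed

lemma sum_cmod_state:
  assumes "query_alg n T A" "t \<le> T"
  shows "(\<Sum>s\<in>basis_states n (workdim A). (cmod (state n A x t s))\<^sup>2) = 1"
  using assms(2)
proof (induction t)
  case 0
  have "(0, False, 0) \<in> basis_states n (workdim A)"
    using assms by (simp add: basis_states_def query_alg_def)
  moreover have "(\<Sum>s\<in>B. (cmod (if s = a then 1 else 0))\<^sup>2) = 1" 
    if "a \<in> B" "finite B" for a :: basis and B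
    using that by (simp add: if_distrib[of cmod] if_distrib[of "\<lambda>u. u\<^sup>2"] cong: if_cong)
  moreover have "unitary_on (basis_states n (workdim A)) (gate A 0)"
    using assms by (simp add: query_alg_def)
  ultimately show ?case
    by (simp only: state.simps sum_cmod_apply_gate finite_basis_states)
next
  case (Suc t)
  then show ?case
    using assms
    by (simp add: sum_cmod_apply_gate sum_cmod_apply_oracle finite_basis_states query_alg_def)
qed

text \<open>It holds for every input \<open>x\<close>, so each output probability is a polynomial
  bounded on the whole cube, not only on the domain.\<close>

lemma sum_output_prob:
  assumes "query_alg n T A"
  shows "output_prob n T A x None + output_prob n T A x (Some False)
    + output_prob n T A x (Some True) = 1"
proof -
  let ?B = "basis_states n (workdim A)"
  let ?S = "\<lambda>v. {s \<in> ?B. outcome A s = v}"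
  have "?B = (\<Union>v\<in>UNIV. ?S v)" by auto
  then have "(\<Sum>s\<in>?B. (cmod (state n A x T s))\<^sup>2)
      = (\<Sum>s\<in>(\<Union>v\<in>UNIV. ?S v). (cmod (state n A x T s))\<^sup>2)" by simp
  also have "\<dots> = (\<Sum>v\<in>UNIV. output_prob n T A x v)"
    unfolding output_prob_def
    by (rule sum.UNION_disjoint) (auto simp: finite_basis_states)
  also have "\<dots> = output_prob n T A x None + output_prob n T A x (Some False)
    + output_prob n T A x (Some True)"
    by (simp add: UNIV_option_conv UNIV_bool sum.reindex)
  finally show ?thesis using sum_cmod_state[OF assms, of T x] by simp
qed

lemma output_prob_nonneg: "0 \<le> output_prob n T A x v"
  unfolding output_prob_def by (intro sum_nonneg) simp

lemma bdeg_fcert_le_Q0: "bdeg n (fcert f z) \<le> enat 4 * Q0 n (fcert f z)"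
  unfolding Q0_def
proof (rule le_mult_INF_enat)
  fix T
  assume "T \<in> {T. \<exists>A. query_alg n T A \<and> zero_error n T A (fcert f z)}"
  then obtain A where A: "query_alg n T A" "zero_error n T A (fcert f z)" by blast
  have z: "output_prob n T A z None \<le> 1 / 2" "output_prob n T A z (Some False) = 0"
    using A(2) fcert_eq_True_iff[of f z z] unfolding zero_error_def by force+
  \<comment> \<open>At \<open>z\<close> the output 1 has probability at least 1/2, so
    \<open>k = 1\<close> suffices; doubling the degree \<open>2 * T\<close> gives the constant
    4.\<close>
  have "bdeg n (fcert f z) \<le> enat (Suc 1 * (2 * T))"
  proof (rule bdeg_le_one_sided[OF deg_le_output_prob, where z = z])
    show "0 \<le> output_prob n T A x (Some True) \<and> output_prob n T A x (Some True) \<le> 1" for x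
      using sum_output_prob[OF A(1), of x] output_prob_nonneg[of n T A x]
      by (smt (verit))
    show "output_prob n T A x (Some True) = 0" if "fcert f z x = Some False" for x
      using A(2) that unfolding zero_error_def by force
    show "1 \<le> (real 1 + 1) * output_prob n T A z (Some True)"
      using sum_output_prob[OF A(1), of z] z by simp
  qed (simp_all add: fcert_eq_True_iff)
  then show "bdeg n (fcert f z) \<le> enat 4 * enat T" by simp
qed simp

section \<open>The comparison of the certificate measures\<close>

text \<open>Bounds for each \<open>z\<close> pass to the supremum; \<open>D\<close> lets several
  constants be merged into one.\<close>

lemma cert_measure_le_mult:
  assumes "\<And>z. z \<in> dom f \<Longrightarrow> M n (fcert f z) \<le> enat C * M' n (fcert f z)" "C \<le> D"
  shows "cert_measure M n f \<le> enat D * cert_measure M' n f"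
  unfolding cert_measure_def
proof (rule SUP_least)
  fix z
  assume z: "z \<in> dom f"
  have "M n (fcert f z) \<le> enat C * M' n (fcert f z)" by (rule assms(1)[OF z])
  also have "\<dots> \<le> enat D * (SUP z\<in>dom f. M' n (fcert f z))"
    using assms(2) z by (intro mult_mono SUP_upper) auto
  finally show "M n (fcert f z) \<le> enat D * (SUP z\<in>dom f. M' n (fcert f z))" .
qed

theorem theorem9:
  fixes \<epsilon> :: real
  assumes "0 < \<epsilon>" and "\<epsilon> < 1"
  shows "\<exists>C::nat. \<forall>(n::nat) (f :: bool list \<rightharpoonup> bool). partial_boolean n f \<longrightarrow>
           cert_measure bdeg n f \<le> enat C * cert_measure (osdeg \<epsilon>) n f \<and>
           cert_measure (osdeg \<epsilon>) n f \<le> enat C * cert_measure bdeg n f \<and>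
           cert_measure (osdeg \<epsilon>) n f \<le> enat C * cert_measure Q0 n f"
proof -
  \<comment> \<open>As \<open>1 - \<epsilon> > 0\<close>, some \<open>k\<close> exceeds
    \<open>1 / (1 - \<epsilon>)\<close>; it depends on \<epsilon> alone, as the constant
    must.\<close>
  obtain k where k: "1 < real k * (1 - \<epsilon>)"
    using assms reals_Archimedean3[of "1 - \<epsilon>"] by auto
  then have "0 < k" by (cases k) auto
  moreover have "1 \<le> (real k + 1) * (1 - \<epsilon>)"
    using k assms by (simp add: algebra_simps)
  ultimately have bdeg: "bdeg n (fcert f z) \<le> enat (Suc k) * osdeg \<epsilon> n (fcert f z)" for n f z
    by (rule bdeg_fcert_le_osdeg)
  have osdeg: "osdeg \<epsilon> n g \<le> enat 1 * bdeg n g" for n g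
    using osdeg_le_bdeg[of \<epsilon> n g] assms
    unfolding one_enat_def[symmetric] mult_1 by simp
  \<comment> \<open>The quantum bound goes through the exact degree:
    \<open>osdeg \<le> bdeg \<le> 4 * Q0\<close> at each \<open>z\<close>.\<close>
  have Q0: "osdeg \<epsilon> n (fcert f z) \<le> enat 4 * Q0 n (fcert f z)" for n f z
    using osdeg_le_bdeg[of \<epsilon> n "fcert f z"] assms bdeg_fcert_le_Q0[of n f z]
    by (meson less_imp_le order_trans)
  show ?thesis
    \<comment> \<open>\<open>k + 4\<close> dominates the three constants \<open>Suc k\<close>, 1 and
      4.\<close>
    by (intro exI[of _ "k + 4"] allI impI conjI)
      (rule cert_measure_le_mult, rule bdeg osdeg Q0, simp)+
qed

end
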